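(* Let $(X,G)$ be a complete $G$-metric space and let $A,B,S,T:X\to X$ be mappings. Let $h\in[0,1)$ be such that for all $x,y\in X$ $$G(Sx,Ty,Ty)\le h\max\{G(Ax,By,By),\,G(Sx,Ax,Ax),\,G(Ty,By,By)\},$$ $$G(Sx,Sx,Ty)\le h\max\{G(Ax,Ax,By),\,G(Sx,Sx,Ax),\,G(Ty,Ty,By)\}.$$ Assume that: 1) $TX\subseteq AX$ and $SX\subseteq BX$; 2) the mappings $A$ and $B$ are sequentially continuous; 3) the pairs $\{A,S\}$ and $\{B,T\}$ are weakly commuting. Then $A,B,S$ and $T$ have a unique common fixed point, i.e. there is exactly one $z\in X$ with $Az=Bz=Sz=Tz=z$.
   Context: A $G$-metric on a nonempty set $X$ is a function $G:X\times X\times X\to[0,\infty)$ such that: (G1) $G(x,y,z)=0$ if $x=y=z$; (G2) $G(x,y,z)>0$ for all $x,y,z\in X$ with $x\ne y$; (G3) $G(x,x,y)\le G(x,y,z)$ for all $x,y,z\in X$ with $y\neq z$; (G4) $G$ is invariant under all permutations of its three arguments; (G5) $G(x,y,z)\le G(x,a,a)+G(a,y,z)$ for all $x,y,z,a\in X$. The pair $(X,G)$ is then called a $G$-metric space (it is not assumed that $G(x,y,y)=G(y,x,x)$). A sequence $(x_n)$ in $X$ is $G$-Cauchy if for every $\varepsilon>0$ there is $n_0$ with $G(x_n,x_m,x_l)<\varepsilon$ for all $n,m,l\ge n_0$. It is $G$-convergent to $x\in X$ if for every $\varepsilon>0$ there is $n_0$ with $G(x,x_n,x_m)<\varepsilon$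 for all $n,m\ge n_0$. The space is ($G$-)complete if every $G$-Cauchy sequence is $G$-convergent in $X$. A map $f:X\to X$ is sequentially continuous if $fx_n$ $G$-converges to $fx$ whenever $x_n$ $G$-converges to $x$. Self-maps $f,g$ of $X$ are weakly commuting if $G(fgx,gfx,gfx)\le G(fx,gx,gx)$ for all $x\in X$, where $fgx=f(g(x))$. For the pair $\{A,S\}$ this is taken with $f=S,\ g=A$, i.e. $G(SAx,ASx,ASx)\le G(Sx,Ax,Ax)$ for all $x\in X$; for the pair $\{B,T\}$ with $f=T,\ g=B$, i.e. $G(TBx,BTx,BTx)\le G(Tx,Bx,Bx)$ for all $x\in X$. Notation: $fX=\{fx:x\in X\}$. *)

theory Defs
  imports Complex_Main
begin

(* G need not be symmetric in the sense G x y y = G y x x.  The two transpositions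
   in G4a and G4b generate all permutations of the three arguments. *)
locale G_metric_space =
  fixes X :: "'a set" and G :: "'a \<Rightarrow> 'a \<Rightarrow> 'a \<Rightarrow> real"
  assumes nonempty: "X \<noteq> {}"
    and nonneg: "\<lbrakk>x \<in> X; y \<in> X; z \<in> X\<rbrakk> \<Longrightarrow> 0 \<le> G x y z"
    and G1: "x \<in> X \<Longrightarrow> G x x x = 0"
    and G2: "\<lbrakk>x \<in> X; y \<in> X; z \<in> X; x \<noteq> y\<rbrakk> \<Longrightarrow> 0 < G x y z"
    and G3: "\<lbrakk>x \<in> X; y \<in> X; z \<in> X; y \<noteq> z\<rbrakk> \<Longrightarrow> G x x y \<le> G x y z"
    and G4a: "\<lbrakk>x \<in> X; y \<in> X; z \<in> X\<rbrakk> \<Longrightarrow> G x y z = G y x z"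
    and G4b: "\<lbrakk>x \<in> X; y \<in> X; z \<in> X\<rbrakk> \<Longrightarrow> G x y z = G x z y"
    and G5: "\<lbrakk>x \<in> X; y \<in> X; z \<in> X; a \<in> X\<rbrakk> \<Longrightarrow> G x y z \<le> G x a a + G a y z"

(* The next two predicates are meant for sequences (and limits) lying in the carrier;
   membership is required where they are used. *)
definition G_Cauchy :: "('a \<Rightarrow> 'a \<Rightarrow> 'a \<Rightarrow> real) \<Rightarrow> (nat \<Rightarrow> 'a) \<Rightarrow> bool" where
  "G_Cauchy G s \<longleftrightarrow>
     (\<forall>\<epsilon>>0. \<exists>n0. \<forall>n\<ge>n0. \<forall>m\<ge>n0. \<forall>l\<ge>n0. G (s n) (s m) (s l) < \<epsilon>)"

definition G_converges_to ::
    "('a \<Rightarrow> 'a \<Rightarrow> 'a \<Rightarrow> real) \<Rightarrow> (nat \<Rightarrow> 'a) \<Rightarrow> 'a \<Rightarrow> bool" where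
  "G_converges_to G s x \<longleftrightarrow>
     (\<forall>\<epsilon>>0. \<exists>n0. \<forall>n\<ge>n0. \<forall>m\<ge>n0. G x (s n) (s m) < \<epsilon>)"

definition G_complete :: "'a set \<Rightarrow> ('a \<Rightarrow> 'a \<Rightarrow> 'a \<Rightarrow> real) \<Rightarrow> bool" where
  "G_complete X G \<longleftrightarrow>
     (\<forall>s. range s \<subseteq> X \<and> G_Cauchy G s \<longrightarrow> (\<exists>x\<in>X. G_converges_to G s x))"

definition G_seq_continuous ::
    "'a set \<Rightarrow> ('a \<Rightarrow> 'a \<Rightarrow> 'a \<Rightarrow> real) \<Rightarrow> ('a \<Rightarrow> 'a) \<Rightarrow> bool" where
  "G_seq_continuous X G f \<longleftrightarrow>
     (\<forall>s. \<forall>x\<in>X. range s \<subseteq> X \<and> G_converges_to G s x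
        \<longrightarrow> G_converges_to G (\<lambda>n. f (s n)) (f x))"

(* The order of f and g matters, because G x y y and G y x x may differ. *)
definition G_weakly_commuting ::
    "'a set \<Rightarrow> ('a \<Rightarrow> 'a \<Rightarrow> 'a \<Rightarrow> real) \<Rightarrow> ('a \<Rightarrow> 'a) \<Rightarrow> ('a \<Rightarrow> 'a) \<Rightarrow> bool" where
  "G_weakly_commuting X G f g \<longleftrightarrow>
     (\<forall>x\<in>X. G (f (g x)) (g (f x)) (g (f x)) \<le> G (f x) (g x) (g x))"

end

theory Submission
  imports Defs
begin

text \<open>The symmetrisation \<open>\<rho> x y = max (G x y y) (G y x x)\<close> is a metric inducing the same
  convergence and Cauchy sequences as \<open>G\<close>, and the two contractive conditions merge into the single
  one \<open>\<rho> (S x) (T y) \<le> h * max {\<rho> (A x) (B y), \<rho> (S x) (A x), \<rho> (T y) (B y)}\<close>. Since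
  \<open>G x y y \<le> 2 * G y x x\<close>, weak commutativity yields \<open>\<rho> (S (A x)) (A (S x)) \<le> 2 * \<rho> (S x) (A x)\<close>,
  and the factor 2 is harmless because it is only used along sequences where the right-hand side
  vanishes. Jungck's iteration \<open>S u\<^sub>n = B v\<^sub>n\<close>, \<open>T v\<^sub>n = A u\<^sub>n\<^sub>+\<^sub>1\<close> is \<open>\<rho>\<close>-Cauchy, and its limit is
  the common fixed point.\<close>

section \<open>Real inequalities and null sequences\<close>

text \<open>If \<open>r\<close> exceeded \<open>s\<close>, the maximum would be \<open>r\<close>
  itself, and \<open>r \<le> h * r\<close> with \<open>h < 1\<close> would force
  \<open>r \<le> 0 \<le> s\<close>. This discards from a contractive bound the very distance being
  estimated.\<close>

lemma le_mult_max_absorb: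
  fixes h r s :: real
  assumes "r \<le> h * max s r" "0 \<le> h" "h < 1" "0 \<le> s"
  shows "r \<le> h * s"
proof (cases "r \<le> s")
  case False
  then have "(1 - h) * r \<le> 0"
    using assms(1) by (simp add: max_def algebra_simps)
  then have "r \<le> 0"
    using assms(3) by (simp add: mult_le_0_iff)
  then show ?thesis
    using False assms(4) by linarith
qed (use assms(1) in \<open>simp add: max_def\<close>)

lemma le_mult_self_imp_le_0:
  fixes h r :: real
  assumes "r \<le> h * r" "h < 1"
  shows "r \<le> 0"
proof -
  have "(1 - h) * r \<le> 0"
    using assms(1) by (simp add: algebra_simps)
  then show ?thesis
    using assms(2) by (simp add: mult_le_0_iff)
qed

lemma LIMSEQ_null_comparison:
  fixes f g :: "nat \<Rightarrow> real"
  assumes "\<And>n. \<bar>f n\<bar> \<le> g n" "g \<longlonglongrightarrow> 0"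
  shows "f \<longlonglongrightarrow> 0"
  using assms(1) by (intro tendsto_0_le[OF assms(2), of _ 1] always_eventually)
    (auto intro: order_trans[OF _ abs_ge_self])

section \<open>The symmetrised metric\<close>

context G_metric_space
begin

definition sym_dist :: "'a \<Rightarrow> 'a \<Rightarrow> real" where
  "sym_dist x y = max (G x y y) (G y x x)"

lemma sym_dist_commute: "sym_dist x y = sym_dist y x"
  by (simp add: sym_dist_def max.commute)

lemma sym_dist_nonneg: "x \<in> X \<Longrightarrow> y \<in> X \<Longrightarrow> 0 \<le> sym_dist x y"
  using nonneg[of x y y] by (simp add: sym_dist_def)

lemma sym_dist_self: "x \<in> X \<Longrightarrow> sym_dist x x = 0"
  by (simp add: sym_dist_def G1)

lemma sym_dist_le_0_imp_eq:
  assumes "x \<in> X" "y \<in> X" "sym_dist x y \<le> 0"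
  shows "x = y"
  using G2[of x y y] assms by (force simp: sym_dist_def)

text \<open>This form matches the shape \<open>G x x y\<close> in which the second contractive
  condition is stated.\<close>

lemma sym_dist_eq: "x \<in> X \<Longrightarrow> y \<in> X \<Longrightarrow> sym_dist x y = max (G x y y) (G x x y)"
  using G4a[of y x x] G4b[of x y x] by (simp add: sym_dist_def)

lemma G_le_sym_dist:
  "G x y y \<le> sym_dist x y"
  "x \<in> X \<Longrightarrow> y \<in> X \<Longrightarrow> G x x y \<le> sym_dist x y"
  by (simp add: sym_dist_def) (simp add: sym_dist_eq)

text \<open>Axiom \<open>G5\<close> with intermediate point \<open>y\<close> gives a triangle
  inequality for each orientation, from \<open>x\<close> to \<open>z\<close> and from
  \<open>z\<close> to \<open>x\<close>; the maximum inherits both.\<close>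

lemma sym_dist_triangle:
  assumes "x \<in> X" "y \<in> X" "z \<in> X"
  shows "sym_dist x z \<le> sym_dist x y + sym_dist y z"
  using G5[of x z z y] G5[of z x x y] assms unfolding sym_dist_def by linarith

text \<open>Taking \<open>a = y\<close> in \<open>G5\<close> bounds \<open>G x y x\<close> by
  \<open>G x y y + G y y x\<close>, and both summands agree up to a permutation of the arguments.
  This stands in for the missing symmetry.\<close>

lemma G_le_double_swap:
  assumes "x \<in> X" "y \<in> X"
  shows "G y x x \<le> 2 * G x y y"
  using G5[of x y x y] G4a[of x y x] G4b[of y y x] G4a[of y x y] assms by simp

lemma sym_dist_le_double: "x \<in> X \<Longrightarrow> y \<in> X \<Longrightarrow> sym_dist x y \<le> 2 * G x y y"
  using G_le_double_swap[of x y] nonneg[of x y y] by (simp add: sym_dist_def)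

lemma G_le_sym_dist_add:
  assumes "x \<in> X" "y \<in> X" "z \<in> X"
  shows "G x y z \<le> sym_dist x y + sym_dist y z"
  using G5[of x y z y] G4b[of y y z] G4a[of y z y] assms by (simp add: sym_dist_def)

section \<open>Convergence and Cauchy sequences through the metric\<close>

lemma G_converges_to_iff_sym_dist:
  assumes "range s \<subseteq> X" "x \<in> X"
  shows "G_converges_to G s x \<longleftrightarrow> (\<lambda>n. sym_dist (s n) x) \<longlonglongrightarrow> 0"
proof
  have s: "s n \<in> X" for n
    using assms(1) by auto
  {
    assume L: "G_converges_to G s x"
    show "(\<lambda>n. sym_dist (s n) x) \<longlonglongrightarrow> 0"
    proof (rule LIMSEQ_I)
      fix e :: real assume "0 < e"
      then obtain n0 where n0: "\<And>n m. n \<ge> n0 \<Longrightarrow> m \<ge> n0 \<Longrightarrow> G x (s n) (s m) < e / 2"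
        using L unfolding G_converges_to_def by (meson half_gt_zero)
      have "norm (sym_dist (s n) x - 0) < e" if "n \<ge> n0" for n
        using n0[OF that that] sym_dist_le_double[OF assms(2) s[of n]]
          sym_dist_nonneg[OF s assms(2), of n] by (simp add: sym_dist_commute)
      then show "\<exists>n0. \<forall>n\<ge>n0. norm (sym_dist (s n) x - 0) < e"
        by blast
    qed
  next
    assume L: "(\<lambda>n. sym_dist (s n) x) \<longlonglongrightarrow> 0"
    show "G_converges_to G s x"
      unfolding G_converges_to_def
    proof (intro allI impI)
      fix e :: real assume "0 < e"
      \<comment> \<open>Three thirds are needed: \<open>G x (s n) (s m)\<close> is at most the
        distance from \<open>x\<close> to \<open>s n\<close> plus that from \<open>s n\<close> to
        \<open>s m\<close>, and the latter is split again at \<open>x\<close>.\<close>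
      then obtain n0 where n0: "\<And>n. n \<ge> n0 \<Longrightarrow> norm (sym_dist (s n) x - 0) < e / 3"
        using LIMSEQ_D[OF L, of "e / 3"] by auto
      have "G x (s n) (s m) < e" if "n \<ge> n0" "m \<ge> n0" for n m
        using n0[OF that(1)] n0[OF that(2)] G_le_sym_dist_add[OF assms(2) s s, of n m]
          sym_dist_triangle[OF s assms(2) s, of n m] sym_dist_commute[of x "s n"]
          sym_dist_commute[of x "s m"] by simp
      then show "\<exists>n0. \<forall>n\<ge>n0. \<forall>m\<ge>n0. G x (s n) (s m) < e"
        by blast
    qed
  }
qed

text \<open>The quadrilateral inequality bounds the change of the distance by the sum of the
  displacements of its two arguments.\<close>

lemma tendsto_sym_dist:
  assumes "range s \<subseteq> X" "range t \<subseteq> X" "x \<in> X" "y \<in> X"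
    and "(\<lambda>n. sym_dist (s n) x) \<longlonglongrightarrow> 0" "(\<lambda>n. sym_dist (t n) y) \<longlonglongrightarrow> 0"
  shows "(\<lambda>n. sym_dist (s n) (t n)) \<longlonglongrightarrow> sym_dist x y"
proof -
  have st: "s n \<in> X" "t n \<in> X" for n
    using assms(1,2) by auto
  have "\<bar>sym_dist (s n) (t n) - sym_dist x y\<bar> \<le> sym_dist (s n) x + sym_dist (t n) y" for n
    using sym_dist_triangle[OF st(1) assms(3) st(2), of n n]
      sym_dist_triangle[OF assms(3,4) st(2), of n]
      sym_dist_triangle[OF assms(3) st(1) assms(4), of n]
      sym_dist_triangle[OF st assms(4), of n n]
      sym_dist_commute[of x "s n"] sym_dist_commute[of y "t n"] by linarith
  moreover have "(\<lambda>n. sym_dist (s n) x + sym_dist (t n) y) \<longlonglongrightarrow> 0"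
    using tendsto_add[OF assms(5,6)] by simp
  ultimately have "(\<lambda>n. sym_dist (s n) (t n) - sym_dist x y) \<longlonglongrightarrow> 0"
    by (rule LIMSEQ_null_comparison)
  then show ?thesis
    by (simp add: LIM_zero_iff)
qed

lemma tendsto_sym_dist_trans:
  assumes "range s \<subseteq> X" "range t \<subseteq> X" "x \<in> X"
    and "(\<lambda>n. sym_dist (s n) x) \<longlonglongrightarrow> 0" "(\<lambda>n. sym_dist (t n) (s n)) \<longlonglongrightarrow> 0"
  shows "(\<lambda>n. sym_dist (t n) x) \<longlonglongrightarrow> 0"
proof (rule LIMSEQ_null_comparison)
  show "\<bar>sym_dist (t n) x\<bar> \<le> sym_dist (t n) (s n) + sym_dist (s n) x" for n
    using assms(1-3) sym_dist_triangle sym_dist_nonneg by (simp add: image_subset_iff)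
  show "(\<lambda>n. sym_dist (t n) (s n) + sym_dist (s n) x) \<longlonglongrightarrow> 0"
    using tendsto_add[OF assms(5,4)] by simp
qed

lemma sym_dist_geometric_tail:
  assumes s: "range s \<subseteq> X" and c: "0 \<le> c" "0 \<le> k" "k < 1"
    and step: "\<And>n. sym_dist (s n) (s (Suc n)) \<le> c * k ^ n"
    and "m \<le> n"
  shows "sym_dist (s m) (s n) \<le> c * k ^ m / (1 - k)"
proof -
  \<comment> \<open>Keeping the exact partial geometric sum, with the term \<open>- k ^ n\<close>,
    makes the induction close; the term is dropped only afterwards.\<close>
  have "sym_dist (s m) (s n) \<le> c * (k ^ m - k ^ n) / (1 - k)"
    using \<open>m \<le> n\<close>
  proof (induction n rule: dec_induct)
    case base
    then show ?case
      using s by (simp add: sym_dist_self image_subset_iff)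
  next
    case (step n)
    have "sym_dist (s m) (s (Suc n)) \<le> sym_dist (s m) (s n) + sym_dist (s n) (s (Suc n))"
      using s by (intro sym_dist_triangle) auto
    also have "\<dots> \<le> c * (k ^ m - k ^ n) / (1 - k) + c * k ^ n"
      using step.IH assms(5)[of n] by linarith
    also have "\<dots> = c * (k ^ m - k ^ Suc n) / (1 - k)"
      using c(3) by (simp add: field_simps)
    finally show ?case .
  qed
  also have "\<dots> \<le> c * k ^ m / (1 - k)"
    using c by (intro divide_right_mono mult_left_mono) auto
  finally show ?thesis .
qed

lemma G_Cauchy_geometric:
  assumes s: "range s \<subseteq> X" and c: "0 \<le> c" "0 \<le> k" "k < 1"
    and step: "\<And>n. sym_dist (s n) (s (Suc n)) \<le> c * k ^ n"
  shows "G_Cauchy G s"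
  unfolding G_Cauchy_def
proof (intro allI impI)
  fix e :: real assume "0 < e"
  have "(\<lambda>n. c / (1 - k) * k ^ n) \<longlonglongrightarrow> 0"
    using tendsto_mult_right_zero[OF LIMSEQ_realpow_zero[OF c(2,3)]] by blast
  \<comment> \<open>A quarter suffices: a detour through \<open>s N\<close> costs two tails, and a
    value of \<open>G\<close> at three terms costs two such detours.\<close>
  then have "\<forall>\<^sub>F n in sequentially. c / (1 - k) * k ^ n < e / 4"
    using \<open>0 < e\<close> by (intro order_tendstoD(2)) auto
  then obtain N where N: "c * k ^ N / (1 - k) < e / 4"
    by (auto simp: eventually_sequentially)
  have X: "s n \<in> X" for n
    using s by auto
  have near: "sym_dist (s n) (s m) < e / 2" if "n \<ge> N" "m \<ge> N" for n m
    using sym_dist_geometric_tail[OF assms that(1)] sym_dist_geometric_tail[OF assms that(2)] N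
      sym_dist_triangle[OF X X X, of n m N] sym_dist_commute[of "s n" "s N"] by linarith
  have "G (s n) (s m) (s l) < e" if "n \<ge> N" "m \<ge> N" "l \<ge> N" for n m l
    using near[OF that(1,2)] near[OF that(2,3)] G_le_sym_dist_add[OF X X X, of n m l] by linarith
  then show "\<exists>N. \<forall>n\<ge>N. \<forall>m\<ge>N. \<forall>l\<ge>N. G (s n) (s m) (s l) < e"
    by blast
qed

section \<open>Limits for weakly commuting pairs\<close>

text \<open>Continuity of \<open>g\<close> handles both \<open>g (g (s n))\<close> and
  \<open>g (f (s n))\<close>. Weak commutativity then moves the limit from
  \<open>g (f (s n))\<close> to \<open>f (g (s n))\<close>, so continuity of \<open>f\<close> is
  never invoked.\<close>

lemma weakly_commuting_tendsto:
  assumes "f ` X \<subseteq> X" "g ` X \<subseteq> X" "G_weakly_commuting X G f g" "G_seq_continuous X G g"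
    and s: "range s \<subseteq> X" "z \<in> X"
    and lims: "(\<lambda>n. sym_dist (f (s n)) z) \<longlonglongrightarrow> 0" "(\<lambda>n. sym_dist (g (s n)) z) \<longlonglongrightarrow> 0"
  shows "(\<lambda>n. sym_dist (g (g (s n))) (g z)) \<longlonglongrightarrow> 0"
    and "(\<lambda>n. sym_dist (f (g (s n))) (g z)) \<longlonglongrightarrow> 0"
proof -
  have X: "s n \<in> X" "f (s n) \<in> X" "g (s n) \<in> X" "f (g (s n)) \<in> X" "g (f (s n)) \<in> X"
    "g (g (s n)) \<in> X" "g z \<in> X" for n
    using assms(1,2) s by (simp_all add: image_subset_iff)
  have cont: "(\<lambda>n. sym_dist (g (t n)) (g z)) \<longlonglongrightarrow> 0"
    if t: "range t \<subseteq> X" "(\<lambda>n. sym_dist (t n) z) \<longlonglongrightarrow> 0" for t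
  proof -
    have "G_converges_to G t z"
      using t s(2) by (simp add: G_converges_to_iff_sym_dist)
    then have "G_converges_to G (\<lambda>n. g (t n)) (g z)"
      using assms(4) t(1) s(2) unfolding G_seq_continuous_def by blast
    moreover have "range (\<lambda>n. g (t n)) \<subseteq> X"
      using t(1) assms(2) by auto
    ultimately show ?thesis
      using X(7) by (simp add: G_converges_to_iff_sym_dist)
  qed
  show "(\<lambda>n. sym_dist (g (g (s n))) (g z)) \<longlonglongrightarrow> 0"
    using X lims(2) by (intro cont) auto
  have gf: "(\<lambda>n. sym_dist (g (f (s n))) (g z)) \<longlonglongrightarrow> 0"
    using X lims(1) by (intro cont) auto
  \<comment> \<open>Both sequences tend to \<open>z\<close>, so their mutual distance tends to
    \<open>sym_dist z z = 0\<close>.\<close>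
  have fg: "(\<lambda>n. 2 * sym_dist (f (s n)) (g (s n))) \<longlonglongrightarrow> 0"
    using tendsto_mult_left[OF tendsto_sym_dist[OF _ _ s(2) s(2) lims], of 2] X
      sym_dist_self[OF s(2)] by auto
  have "norm (sym_dist (f (g (s n))) (g (f (s n)))) \<le> 2 * sym_dist (f (s n)) (g (s n))" for n
  proof -
    have "sym_dist (f (g (s n))) (g (f (s n))) \<le> 2 * G (f (g (s n))) (g (f (s n))) (g (f (s n)))"
      using X by (intro sym_dist_le_double)
    also have "\<dots> \<le> 2 * G (f (s n)) (g (s n)) (g (s n))"
      using assms(3) X unfolding G_weakly_commuting_def by auto
    also have "\<dots> \<le> 2 * sym_dist (f (s n)) (g (s n))"
      by (simp add: sym_dist_def)
    finally show ?thesis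
      using sym_dist_nonneg[OF X(4,5), of n n] by simp
  qed
  then have "(\<lambda>n. sym_dist (f (g (s n))) (g (f (s n)))) \<longlonglongrightarrow> 0"
    by (intro LIMSEQ_null_comparison[OF _ fg]) simp
  then show "(\<lambda>n. sym_dist (f (g (s n))) (g z)) \<longlonglongrightarrow> 0"
    using X s(2) by (intro tendsto_sym_dist_trans[OF _ _ _ gf]) auto
qed

section \<open>The iteration and the common fixed point\<close>

text \<open>The range inclusions provide choice functions: \<open>p x\<close> is a
  \<open>B\<close>-preimage of \<open>S x\<close> and \<open>q x\<close> an
  \<open>A\<close>-preimage of \<open>T x\<close>. Iterating \<open>q\<close> after \<open>p\<close>
  gives \<open>u\<close>, and \<open>v\<close> is the image of \<open>u\<close> under
  \<open>p\<close>.\<close>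

lemma ex_Jungck_iteration:
  assumes "T ` X \<subseteq> A ` X" "S ` X \<subseteq> B ` X"
  shows "\<exists>u v. range u \<subseteq> X \<and> range v \<subseteq> X \<and>
    (\<forall>n::nat. S (u n) = B (v n) \<and> T (v n) = A (u (Suc n)))"
proof -
  have "\<forall>x\<in>X. \<exists>y. y \<in> X \<and> S x = B y" "\<forall>x\<in>X. \<exists>y. y \<in> X \<and> T x = A y"
    using assms by blast+
  then obtain p q where p: "\<And>x. x \<in> X \<Longrightarrow> p x \<in> X \<and> S x = B (p x)"
    and q: "\<And>x. x \<in> X \<Longrightarrow> q x \<in> X \<and> T x = A (q x)"
    unfolding bchoice_iff by blast
  obtain x0 where "x0 \<in> X"
    using nonempty by blast
  define u where "u n = ((\<lambda>x. q (p x)) ^^ n) x0" for n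
  have u: "u n \<in> X" for n
    unfolding u_def by (induction n) (use \<open>x0 \<in> X\<close> p q in auto)
  have "u (Suc n) = q (p (u n))" for n
    by (simp add: u_def)
  then show ?thesis
    using u p q by (intro exI[of _ u] exI[of _ "\<lambda>n. p (u n)"]) (simp add: image_subset_iff)
qed

lemma common_fixed_point:
  assumes complete: "G_complete X G"
    and maps: "A ` X \<subseteq> X" "B ` X \<subseteq> X" "S ` X \<subseteq> X" "T ` X \<subseteq> X"
    and h: "0 \<le> h" "h < 1"
    and contr: "\<And>x y. x \<in> X \<Longrightarrow> y \<in> X \<Longrightarrow> sym_dist (S x) (T y) \<le>
      h * max (sym_dist (A x) (B y)) (max (sym_dist (S x) (A x)) (sym_dist (T y) (B y)))"
    and ranges: "T ` X \<subseteq> A ` X" "S ` X \<subseteq> B ` X"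
    and cont: "G_seq_continuous X G A" "G_seq_continuous X G B"
    and comm: "G_weakly_commuting X G S A" "G_weakly_commuting X G T B"
  shows "\<exists>!z. z \<in> X \<and> A z = z \<and> B z = z \<and> S z = z \<and> T z = z"
proof (rule ex_ex1I)
  obtain u v where uv: "range u \<subseteq> X" "range v \<subseteq> X"
      and SB: "\<And>n::nat. S (u n) = B (v n)" and TA: "\<And>n. T (v n) = A (u (Suc n))"
    using ex_Jungck_iteration[OF ranges] by metis
  have X: "u n \<in> X" "v n \<in> X" "S (u n) \<in> X" "T (v n) \<in> X" for n
    using uv maps by (simp_all add: image_subset_iff)
  \<comment> \<open>\<open>\<alpha>\<close> and \<open>\<beta>\<close> are the successive distances
    in the interleaved sequence \<open>S (u 0)\<close>, \<open>T (v 0)\<close>,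
    \<open>S (u 1)\<close>, \<open>T (v 1)\<close> and so on.\<close>
  define \<alpha> where "\<alpha> n = sym_dist (S (u n)) (T (v n))" for n
  define \<beta> where "\<beta> n = sym_dist (S (u (Suc n))) (T (v n))" for n
  have nonneg_\<alpha>\<beta>: "0 \<le> \<alpha> n" "0 \<le> \<beta> n" for n
    using X by (simp_all add: \<alpha>_def \<beta>_def sym_dist_nonneg)
  have \<beta>_le: "\<beta> n \<le> h * \<alpha> n" for n
  proof (rule le_mult_max_absorb[OF _ h nonneg_\<alpha>\<beta>(1)])
    \<comment> \<open>At \<open>u (Suc n)\<close> and \<open>v n\<close> one has
      \<open>A (u (Suc n)) = T (v n)\<close> and \<open>B (v n) = S (u n)\<close>, so the three
      distances in the maximum are \<open>\<alpha> n\<close>, \<open>\<beta> n\<close>,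
      \<open>\<alpha> n\<close>.\<close>
    show "\<beta> n \<le> h * max (\<alpha> n) (\<beta> n)"
      using contr[OF X(1,2), of "Suc n" n]
      by (simp add: \<alpha>_def \<beta>_def SB TA[symmetric] sym_dist_commute max.commute max.left_commute)
  qed
  have \<alpha>_le: "\<alpha> (Suc n) \<le> h * \<beta> n" for n
  proof (rule le_mult_max_absorb[OF _ h nonneg_\<alpha>\<beta>(2)])
    \<comment> \<open>With both indices equal to \<open>Suc n\<close>, the three distances are
      \<open>\<beta> n\<close>, \<open>\<beta> n\<close>, \<open>\<alpha> (Suc n)\<close>.\<close>
    show "\<alpha> (Suc n) \<le> h * max (\<beta> n) (\<alpha> (Suc n))"
      using contr[OF X(1,2), of "Suc n" "Suc n"]
      by (simp add: \<alpha>_def \<beta>_def SB TA[symmetric] sym_dist_commute max.commute max.left_commute)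
  qed
  have geom: "\<alpha> n \<le> \<alpha> 0 * (h * h) ^ n" for n
  proof (induction n)
    case (Suc n)
    have "\<alpha> (Suc n) \<le> h * h * \<alpha> n"
      using \<alpha>_le[of n] mult_left_mono[OF \<beta>_le[of n] h(1)] by (simp add: mult.assoc)
    also have "\<dots> \<le> h * h * (\<alpha> 0 * (h * h) ^ n)"
      using Suc h(1) by (intro mult_left_mono) auto
    finally show ?case
      by (simp add: algebra_simps)
  qed simp
  have hh: "0 \<le> h * h" "h * h < 1"
    using h mult_left_mono[of h 1 h] by simp_all
  \<comment> \<open>Only the \<open>S\<close>-terms are shown to be Cauchy; the
    \<open>T\<close>-terms then share their limit because \<open>\<alpha>\<close> tends to
    0.\<close>
  have "G_Cauchy G (\<lambda>n. S (u n))"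
  proof (rule G_Cauchy_geometric[OF _ _ hh])
    show "range (\<lambda>n. S (u n)) \<subseteq> X" "0 \<le> 2 * \<alpha> 0"
      using X nonneg_\<alpha>\<beta> by auto
    fix n
    have "sym_dist (S (u n)) (S (u (Suc n))) \<le> \<alpha> n + \<beta> n"
      using sym_dist_triangle[OF X(3) X(4) X(3), of n "Suc n" n]
      by (simp add: \<alpha>_def \<beta>_def sym_dist_commute)
    also have "\<beta> n \<le> \<alpha> n"
      using \<beta>_le[of n] mult_right_mono[of h 1 "\<alpha> n"] nonneg_\<alpha>\<beta>(1)[of n] h by simp
    finally show "sym_dist (S (u n)) (S (u (Suc n))) \<le> 2 * \<alpha> 0 * (h * h) ^ n"
      using geom[of n] by linarith
  qed
  moreover have "range (\<lambda>n. S (u n)) \<subseteq> X"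
    using X by auto
  ultimately obtain z where z: "z \<in> X" and "G_converges_to G (\<lambda>n. S (u n)) z"
    using complete unfolding G_complete_def by blast
  then have Su: "(\<lambda>n. sym_dist (S (u n)) z) \<longlonglongrightarrow> 0"
    using \<open>range (\<lambda>n. S (u n)) \<subseteq> X\<close> by (simp add: G_converges_to_iff_sym_dist)
  have "(\<lambda>n. \<alpha> 0 * (h * h) ^ n) \<longlonglongrightarrow> 0"
    using tendsto_mult_right_zero[OF LIMSEQ_realpow_zero[OF hh]] by blast
  then have "\<alpha> \<longlonglongrightarrow> 0"
    by (rule LIMSEQ_null_comparison[rotated]) (simp add: geom nonneg_\<alpha>\<beta>(1))
  then have "(\<lambda>n. sym_dist (T (v n)) (S (u n))) \<longlonglongrightarrow> 0"
    by (simp add: \<alpha>_def[abs_def] sym_dist_commute)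
  then have Tv: "(\<lambda>n. sym_dist (T (v n)) z) \<longlonglongrightarrow> 0"
    using X z by (intro tendsto_sym_dist_trans[OF _ _ _ Su]) auto
  \<comment> \<open>The shift turns \<open>A (w n)\<close> into \<open>T (v n)\<close>, so
    \<open>S\<close> and \<open>A\<close> have the common limit \<open>z\<close> along
    \<open>w\<close>, as \<open>T\<close> and \<open>B\<close> do along \<open>v\<close>.\<close>
  define w where "w n = u (Suc n)" for n
  have Sw: "(\<lambda>n. sym_dist (S (w n)) z) \<longlonglongrightarrow> 0"
    using LIMSEQ_Suc[OF Su] by (simp add: w_def)
  have Aw: "(\<lambda>n. sym_dist (A (w n)) z) \<longlonglongrightarrow> 0"
    using Tv by (simp add: TA w_def)
  have Bv: "(\<lambda>n. sym_dist (B (v n)) z) \<longlonglongrightarrow> 0"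
    using Su by (simp add: SB)
  have w: "range w \<subseteq> X"
    using X by (auto simp: w_def)
  have closed: "A x \<in> X" "B x \<in> X" "S x \<in> X" "T x \<in> X" if "x \<in> X" for x
    using maps that by (simp_all add: image_subset_iff)
  have W: "w n \<in> X" for n
    using w by auto
  note AAw = weakly_commuting_tendsto(1)[OF maps(3,1) comm(1) cont(1) w z Sw Aw]
  note SAw = weakly_commuting_tendsto(2)[OF maps(3,1) comm(1) cont(1) w z Sw Aw]
  note BBv = weakly_commuting_tendsto(1)[OF maps(4,2) comm(2) cont(2) uv(2) z Tv Bv]
  note TBv = weakly_commuting_tendsto(2)[OF maps(4,2) comm(2) cont(2) uv(2) z Tv Bv]

  \<comment> \<open>The contraction passes to limits by continuity of the metric and of
    \<open>max\<close>. Leaving sequences and limits free also admits constant sequences at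
    \<open>z\<close>.\<close>
  have limit_contr: "sym_dist S' T'
      \<le> h * max (sym_dist A' B') (max (sym_dist S' A') (sym_dist T' B'))"
    if "\<forall>n. s n \<in> X" "\<forall>n. t n \<in> X" "S' \<in> X" "T' \<in> X" "A' \<in> X" "B' \<in> X"
      "(\<lambda>n. sym_dist (S (s n)) S') \<longlonglongrightarrow> 0" "(\<lambda>n. sym_dist (T (t n)) T') \<longlonglongrightarrow> 0"
      "(\<lambda>n. sym_dist (A (s n)) A') \<longlonglongrightarrow> 0" "(\<lambda>n. sym_dist (B (t n)) B') \<longlonglongrightarrow> 0"
    for s t S' T' A' B'
  proof (rule LIMSEQ_le)
    have X': "s n \<in> X" "t n \<in> X" for n
      using that(1,2) by auto
    then have r: "range (\<lambda>n. S (s n)) \<subseteq> X" "range (\<lambda>n. T (t n)) \<subseteq> X"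
        "range (\<lambda>n. A (s n)) \<subseteq> X" "range (\<lambda>n. B (t n)) \<subseteq> X"
      using closed by auto
    show "(\<lambda>n. sym_dist (S (s n)) (T (t n))) \<longlonglongrightarrow> sym_dist S' T'"
      using r that by (intro tendsto_sym_dist)
    show "(\<lambda>n. h * max (sym_dist (A (s n)) (B (t n)))
          (max (sym_dist (S (s n)) (A (s n))) (sym_dist (T (t n)) (B (t n)))))
        \<longlonglongrightarrow> h * max (sym_dist A' B') (max (sym_dist S' A') (sym_dist T' B'))"
      using r that by (intro tendsto_mult_left tendsto_max tendsto_sym_dist)
    show "\<exists>N. \<forall>n\<ge>N. sym_dist (S (s n)) (T (t n)) \<le> h * max (sym_dist (A (s n)) (B (t n)))
          (max (sym_dist (S (s n)) (A (s n))) (sym_dist (T (t n)) (B (t n))))"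
      using contr X' by blast
  qed

  have eqI: "x = y" if "x \<in> X" "y \<in> X" "sym_dist x y \<le> h * sym_dist x y" for x y
    using that h(2) by (intro sym_dist_le_0_imp_eq le_mult_self_imp_le_0)
  have AB: "A z = B z"
  proof (rule eqI)
    \<comment> \<open>Along \<open>A (w n)\<close> and \<open>B (v n)\<close>, the images under
      \<open>S\<close> and \<open>A\<close> tend to \<open>A z\<close> and those under
      \<open>T\<close> and \<open>B\<close> to \<open>B z\<close>, so only the first distance in the
      maximum survives.\<close>
    show "sym_dist (A z) (B z) \<le> h * sym_dist (A z) (B z)"
      using limit_contr[of "\<lambda>n. A (w n)" "\<lambda>n. B (v n)", OF _ _ _ _ _ _ SAw TBv AAw BBv]
        W X z closed by (auto simp: sym_dist_self sym_dist_nonneg)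
  qed (use z closed in auto)
  have SA: "S z = A z"
  proof (rule eqI)
    \<comment> \<open>The constant sequence \<open>z\<close> is paired with \<open>B (v n)\<close>;
      since \<open>A z = B z\<close>, only the distance from \<open>S z\<close> to
      \<open>A z\<close> remains.\<close>
    show "sym_dist (S z) (A z) \<le> h * sym_dist (S z) (A z)"
      using limit_contr[of "\<lambda>n. z" "\<lambda>n. B (v n)" "S z" "B z" "A z", OF _ _ _ _ _ _ _ TBv _ BBv]
        X z closed by (auto simp: sym_dist_self sym_dist_nonneg AB max_absorb1 max_absorb2)
  qed (use z closed in auto)
  have TB: "T z = B z"
  proof (rule eqI)
    show "sym_dist (T z) (B z) \<le> h * sym_dist (T z) (B z)"
      using contr[OF z z] z closed
      by (auto simp: sym_dist_self sym_dist_nonneg SA AB sym_dist_commute max_absorb2)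
  qed (use z closed in auto)
  have "z = T z"
  proof (rule eqI)
    \<comment> \<open>Pairing \<open>w\<close> with the constant \<open>z\<close> brings in
      \<open>z\<close> itself as the limit of \<open>S (w n)\<close> and \<open>A (w n)\<close>; the
      other two limits are \<open>T z = B z\<close>.\<close>
    show "sym_dist z (T z) \<le> h * sym_dist z (T z)"
      using limit_contr[of w "\<lambda>n. z" z "T z" z "B z", OF _ _ _ _ _ _ Sw _ Aw _]
        w z closed by (auto simp: sym_dist_self sym_dist_nonneg TB max_absorb1)
  qed (use z closed in auto)
  then show "\<exists>z. z \<in> X \<and> A z = z \<and> B z = z \<and> S z = z \<and> T z = z"
    using z AB SA TB by auto
next
  fix x y
  assume x: "x \<in> X \<and> A x = x \<and> B x = x \<and> S x = x \<and> T x = x"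
    and y: "y \<in> X \<and> A y = y \<and> B y = y \<and> S y = y \<and> T y = y"
  then have "sym_dist x y \<le> h * sym_dist x y"
    using contr[of x y] by (simp add: sym_dist_self sym_dist_nonneg max_absorb1)
  then show "x = y"
    using x y h(2) by (intro sym_dist_le_0_imp_eq le_mult_self_imp_le_0) auto
qed

end

theorem theorem1:
  fixes X :: "'a set" and G :: "'a \<Rightarrow> 'a \<Rightarrow> 'a \<Rightarrow> real"
    and A B S T :: "'a \<Rightarrow> 'a" and h :: real
  assumes "G_metric_space X G" and "G_complete X G"
    and "A ` X \<subseteq> X" and "B ` X \<subseteq> X" and "S ` X \<subseteq> X" and "T ` X \<subseteq> X"
    and "0 \<le> h" and "h < 1"
    and "\<forall>x\<in>X. \<forall>y\<in>X. G (S x) (T y) (T y) \<le>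
           h * Max {G (A x) (B y) (B y), G (S x) (A x) (A x), G (T y) (B y) (B y)}"
    and "\<forall>x\<in>X. \<forall>y\<in>X. G (S x) (S x) (T y) \<le>
           h * Max {G (A x) (A x) (B y), G (S x) (S x) (A x), G (T y) (T y) (B y)}"
    and "T ` X \<subseteq> A ` X" and "S ` X \<subseteq> B ` X"
    and "G_seq_continuous X G A" and "G_seq_continuous X G B"
    and "G_weakly_commuting X G S A" and "G_weakly_commuting X G T B"
  shows "\<exists>!z. z \<in> X \<and> A z = z \<and> B z = z \<and> S z = z \<and> T z = z"
proof -
  interpret G_metric_space X G
    by fact
  \<comment> \<open>Each oriented maximum is bounded by the one symmetric maximum \<open>?M\<close>,
    so both conditions have the same right-hand side and their left-hand sides can be combined by
    \<open>max\<close>.\<close>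
  have contr: "sym_dist (S x) (T y) \<le>
      h * max (sym_dist (A x) (B y)) (max (sym_dist (S x) (A x)) (sym_dist (T y) (B y)))"
      (is "_ \<le> h * ?M") if "x \<in> X" "y \<in> X" for x y
  proof -
    have X: "A x \<in> X" "S x \<in> X" "B y \<in> X" "T y \<in> X"
      using that assms(3-6) by (simp_all add: image_subset_iff)
    have "Max {G (A x) (B y) (B y), G (S x) (A x) (A x), G (T y) (B y) (B y)} \<le> ?M"
      using G_le_sym_dist(1) by (subst Max_le_iff) (auto simp: le_max_iff_disj)
    then have 1: "G (S x) (T y) (T y) \<le> h * ?M"
      using assms(7,9) that by (meson mult_left_mono order_trans)
    have "Max {G (A x) (A x) (B y), G (S x) (S x) (A x), G (T y) (T y) (B y)} \<le> ?M"
      using X G_le_sym_dist(2) by (subst Max_le_iff) (auto simp: le_max_iff_disj)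
    then have "G (S x) (S x) (T y) \<le> h * ?M"
      using assms(7,10) that by (meson mult_left_mono order_trans)
    then show ?thesis
      using 1 sym_dist_eq X by simp
  qed
  show ?thesis
    using assms(2-8) contr assms(11-16) by (rule common_fixed_point)
qed

end
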